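(* Let $X$ be a class of graphs and $c$ a constant. Suppose that $Y$ is a class of graphs admitting an implicit representation, and that every graph $G\in X$ has a covering by graphs from $Y$ such that every vertex of $G$ is covered by (i.e. belongs to) at most $c$ graphs of the covering. Then $X$ admits an implicit representation.
   Context: Graphs are finite, simple and undirected; classes of graphs are closed under isomorphism. A set of graphs $H_1,\ldots,H_k$ is a covering of a graph $G$ if $V(G)=\bigcup_{i=1}^k V(H_i)$ and $E(G)=\bigcup_{i=1}^k E(H_i)$. A class $X$ of graphs admits an implicit representation if the vertices of every $n$-vertex graph $G\in X$ can be assigned binary codes of length $O(\log n)$ (with constant depending only on $X$) so that the adjacency of any two vertices is a function of their two codes, the function depending only on $X$. *)

theory Defs
  imports
    "Graph_Theory.Pair_Digraph"
    "Graph_Theory.Digraph_Isomorphism"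
    "HOL-Library.Landau_Symbols"
begin

text \<open>
  A finite simple undirected graph is a \<open>pair_graph\<close>: finitely many vertices, no loops, and an
  edge \<open>uv\<close> is represented by the two arcs \<open>(u, v)\<close> and \<open>(v, u)\<close>.

  A class of graphs consists of graphs whose vertices are drawn from a type \<open>'a\<close> and is closed
  under isomorphism. For infinite \<open>'a\<close>, for example \<open>nat\<close>, every finite graph has an isomorphic
  copy with vertices in \<open>'a\<close>, so such sets correspond to the isomorphism-closed classes of
  finite graphs.
\<close>

definition graph_class :: "'a pair_pre_digraph set \<Rightarrow> bool" where
  "graph_class X \<longleftrightarrow>
     (\<forall>G\<in>X. pair_graph G) \<and>
     (\<forall>G\<in>X. \<forall>H. pair_graph H \<longrightarrow> digraph_iso (with_proj G) (with_proj H) \<longrightarrow> H \<in> X)"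

definition covering :: "'a pair_pre_digraph \<Rightarrow> 'a pair_pre_digraph set \<Rightarrow> bool" where
  "covering G \<H> \<longleftrightarrow>
     finite \<H> \<and> (\<forall>H\<in>\<H>. pair_graph H) \<and>
     pverts G = (\<Union>H\<in>\<H>. pverts H) \<and>
     parcs G = (\<Union>H\<in>\<H>. parcs H)"

text \<open>
  Both the length bound \<open>len\<close> and the decoder \<open>adj\<close> are chosen before the graph \<open>G\<close>, so they
  depend only on the class. The decoder is only required to be correct on pairs of distinct
  vertices, and codes need not be distinct.
\<close>

definition implicit_representation :: "'a pair_pre_digraph set \<Rightarrow> bool" where
  "implicit_representation X \<longleftrightarrow>
     (\<exists>(len :: nat \<Rightarrow> nat) (adj :: bool list \<Rightarrow> bool list \<Rightarrow> bool).
        (\<lambda>n. real (len n)) \<in> O(\<lambda>n. ln (real n)) \<and>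
        (\<forall>G\<in>X. \<exists>code :: 'a \<Rightarrow> bool list.
           (\<forall>v\<in>pverts G. length (code v) \<le> len (card (pverts G))) \<and>
           (\<forall>u\<in>pverts G. \<forall>v\<in>pverts G. u \<noteq> v \<longrightarrow>
              ((u, v) \<in> parcs G \<longleftrightarrow> adj (code u) (code v)))))"

end

theory Submission
  imports Defs "HOL-Real_Asymp.Real_Asymp"
begin

text \<open>
  Fix a graph \<open>G\<close> of \<open>X\<close> with \<open>n\<close> vertices and a covering \<open>\<H>\<close> of it by graphs of \<open>Y\<close>. Two vertices
  of \<open>G\<close> are adjacent iff they are adjacent in a common member of \<open>\<H>\<close>, so it suffices that the code
  of a vertex lists, for each of the at most \<open>c\<close> members \<open>H\<close> containing it, a name of \<open>H\<close> together
  with the code of the vertex in \<open>H\<close>: the decoder looks for an equal name in both lists and runs the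
  decoder of \<open>Y\<close> on the accompanying codes.

  Three points make the resulting code have length \<open>O(log n)\<close>. Counting incidences of vertices and
  members shows that at most \<open>c n\<close> members are nonempty, so names of \<open>O(log n)\<close> bits suffice
  (\<open>card_nonempty_members_le\<close>, \<open>ex_names\<close>). Members are no larger than \<open>G\<close>, and a
  logarithmically bounded length function may be assumed monotone (\<open>ex_mono_majorant_bigo_ln\<close>), so
  codes in members have \<open>O(log n)\<close> bits. Finally a list of pairs of bit strings is written as a single
  bit string with a prefix-free code that costs only a constant factor (\<open>inj_encode_pairs\<close>).
\<close>

section \<open>Self-delimiting encoding of lists of bit strings\<close>

text \<open>
  Each bit is announced by \<open>True\<close> and the end of the string is marked by \<open>False\<close>, which makes the
  encoding prefix-free.
\<close>

fun self_delimit :: "bool list \<Rightarrow> bool list" where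
  "self_delimit [] = [False]"
| "self_delimit (b # bs) = True # b # self_delimit bs"

lemma length_self_delimit: "length (self_delimit xs) = 2 * length xs + 1"
  by (induction xs) auto

lemma self_delimit_append_eq_iff:
  "self_delimit xs @ s = self_delimit ys @ t \<longleftrightarrow> xs = ys \<and> s = t"
proof (induction xs arbitrary: ys)
  case Nil
  show ?case by (cases ys) auto
next
  case (Cons x xs)
  show ?case by (cases ys) (auto simp: Cons.IH)
qed

fun encode_pairs :: "(bool list \<times> bool list) list \<Rightarrow> bool list" where
  "encode_pairs [] = []"
| "encode_pairs ((i, a) # ps) = self_delimit i @ self_delimit a @ encode_pairs ps"

lemma self_delimit_neq_Nil [simp]: "self_delimit xs \<noteq> []"
  by (cases xs) auto

lemma inj_encode_pairs: "inj encode_pairs"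
proof (rule injI)
  show "ps = qs" if "encode_pairs ps = encode_pairs qs" for ps qs
    using that
  proof (induction ps arbitrary: qs rule: encode_pairs.induct)
    case 1
    then show ?case by (cases qs rule: encode_pairs.cases) auto
  next
    case (2 i a ps)
    then show ?case
      by (cases qs rule: encode_pairs.cases) (auto simp: self_delimit_append_eq_iff)
  qed
qed

lemma length_encode_pairs_le:
  assumes "\<And>i a. (i, a) \<in> set ps \<Longrightarrow> length i \<le> l \<and> length a \<le> m"
  shows "length (encode_pairs ps) \<le> length ps * (2 * l + 2 * m + 2)"
  using assms
proof (induction ps rule: encode_pairs.induct)
  case 1
  show ?case by simp
next
  case (2 i a ps)
  have "length i \<le> l" "length a \<le> m"
    using "2.prems"[of i a] by auto
  moreover have "length (encode_pairs ps) \<le> length ps * (2 * l + 2 * m + 2)"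
    using 2 by auto
  ultimately show ?case
    by (simp add: length_self_delimit)
qed

section \<open>Logarithmic bounds\<close>

lemma const_bigo_ln: "(\<lambda>_. a) \<in> O(\<lambda>n. ln (real n))"
  for a :: real
  by real_asymp

text \<open>
  An asymptotic bound says nothing about small arguments, and a length function need not be
  monotone. Since small members may occur in the covering of a large graph, the running maximum
  is what bounds the codes of all members; it exceeds the asymptotic bound by at most a constant.
\<close>

lemma ex_mono_majorant_bigo_ln:
  fixes f :: "nat \<Rightarrow> nat"
  assumes "(\<lambda>n. real (f n)) \<in> O(\<lambda>n. ln (real n))"
  obtains g :: "nat \<Rightarrow> nat"
    where "mono g" "\<And>n. f n \<le> g n" "(\<lambda>n. real (g n)) \<in> O(\<lambda>n. ln (real n))"
proof -
  have ln_nonneg: "0 \<le> ln (real n)" for n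
    by (cases n) auto
  have ln_mono: "ln (real m) \<le> ln (real n)" if "m \<le> n" for m n
    using that ln_nonneg[of n] by (cases m) auto
  from assms obtain C where "C > 0"
    and "eventually (\<lambda>n. norm (real (f n)) \<le> C * norm (ln (real n))) at_top"
    by (elim landau_o.bigE)
  then obtain N where N: "real (f n) \<le> C * ln (real n)" if "n \<ge> N" for n
    using ln_nonneg by (auto simp: eventually_at_top_linorder)
  define K where "K = (\<Sum>k<N. f k)"
  define g where "g n = Max (f ` {..n})" for n
  have bound: "real (f m) \<le> real K + C * ln (real n)" if "m \<le> n" for m n
  proof (cases "m < N")
    case True
    then have "f m \<le> K"
      unfolding K_def by (intro member_le_sum) auto
    moreover have "0 \<le> C * ln (real n)"
      using \<open>C > 0\<close> ln_nonneg by simp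
    ultimately show ?thesis by linarith
  next
    case False
    then have "real (f m) \<le> C * ln (real m)"
      using N by simp
    also have "\<dots> \<le> C * ln (real n)"
      using \<open>C > 0\<close> ln_mono[OF that] by simp
    finally show ?thesis by simp
  qed
  have g_le: "real (g n) \<le> real K + C * ln (real n)" for n
  proof -
    have "g n \<in> f ` {..n}"
      unfolding g_def by (intro Max_in) auto
    then show ?thesis using bound by auto
  qed
  show thesis
  proof
    show "mono g"
      unfolding g_def by (intro monoI Max_mono) auto
    show "f n \<le> g n" for n
      unfolding g_def by (intro Max_ge) auto
    have "(\<lambda>n. real (g n)) \<in> O(\<lambda>n. real K + C * ln (real n))"
      by (intro landau_o.big_mono always_eventually allI)
        (use g_le in \<open>auto intro: order_trans[OF _ abs_ge_self]\<close>)
    also have "(\<lambda>n. real K + C * ln (real n)) \<in> O(\<lambda>n. ln (real n))"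
      by (intro sum_in_bigo const_bigo_ln) simp
    finally show "(\<lambda>n. real (g n)) \<in> O(\<lambda>n. ln (real n))" .
  qed
qed

section \<open>Naming the members of a covering\<close>

text \<open>
  Enough bits to tell \<open>c n\<close> members apart; since \<open>c \<le> 2 ^ c\<close>, the constant number \<open>c\<close> of bits
  accounts for the factor \<open>c\<close>, also when it is zero.
\<close>

definition name_length :: "nat \<Rightarrow> nat \<Rightarrow> nat" where
  "name_length c n = c + nat \<lceil>log 2 (real n)\<rceil>"

lemma le_two_power_name_length: "c * n \<le> 2 ^ name_length c n"
proof (cases "n = 0")
  case False
  have "c \<le> 2 ^ c"
    by (simp add: less_imp_le)
  moreover have "n \<le> 2 ^ nat \<lceil>log 2 (real n)\<rceil>"
  proof -
    have "real n = 2 powr log 2 (real n)"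
      using False by simp
    also have "\<dots> \<le> 2 powr real (nat \<lceil>log 2 (real n)\<rceil>)"
      by (intro powr_mono) linarith+
    also have "\<dots> = real (2 ^ nat \<lceil>log 2 (real n)\<rceil>)"
      by (simp add: powr_realpow)
    finally show ?thesis by (simp only: of_nat_le_iff)
  qed
  ultimately show ?thesis
    by (simp add: name_length_def power_add mult_le_mono)
qed simp

lemma name_length_bigo_ln: "(\<lambda>n. real (name_length c n)) \<in> O(\<lambda>n. ln (real n))"
proof -
  have "(\<lambda>n. real (nat \<lceil>log 2 (real n)\<rceil>)) \<in> O(\<lambda>n. ln (real n))"
    by real_asymp
  then show ?thesis
    unfolding name_length_def of_nat_add by (intro sum_in_bigo const_bigo_ln)
qed

lemma ex_names:
  assumes "finite S" "card S \<le> 2 ^ l"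
  obtains name :: "'b \<Rightarrow> bool list" where "inj_on name S" "\<And>x. x \<in> S \<Longrightarrow> length (name x) = l"
proof -
  let ?B = "{xs :: bool list. set xs \<subseteq> UNIV \<and> length xs = l}"
  have "finite ?B" "card ?B = 2 ^ l"
    using finite_lists_length_eq[of "UNIV :: bool set" l]
      card_lists_length_eq[of "UNIV :: bool set" l] by auto
  then obtain name where "name ` S \<subseteq> ?B" "inj_on name S"
    using assms card_le_inj[of S ?B] by auto
  then show thesis
    using that by (simp add: image_subset_iff)
qed

text \<open>
  Every nonempty member contains a vertex, and every vertex is in at most \<open>c\<close> members. Nonemptiness
  matters: the empty graph can be a member without containing any vertex.
\<close>

lemma card_nonempty_members_le:
  assumes cov: "covering G \<H>"
    and fin: "finite (pverts G)"
    and c: "\<And>v. v \<in> pverts G \<Longrightarrow> card {H \<in> \<H>. v \<in> pverts H} \<le> c"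
  shows "card {H \<in> \<H>. pverts H \<noteq> {}} \<le> c * card (pverts G)"
proof -
  have "{H \<in> \<H>. pverts H \<noteq> {}} = (\<Union>v\<in>pverts G. {H \<in> \<H>. v \<in> pverts H})"
    using cov by (auto simp: covering_def)
  also have "card \<dots> \<le> (\<Sum>v\<in>pverts G. card {H \<in> \<H>. v \<in> pverts H})"
    using fin by (rule card_UN_le)
  also have "\<dots> \<le> (\<Sum>v\<in>pverts G. c)"
    by (intro sum_mono c)
  finally show ?thesis by (simp add: mult.commute)
qed

section \<open>Coding a covered graph\<close>

text \<open>
  The decoder may be an arbitrary function, so the list of pairs is recovered with
  \<open>inv encode_pairs\<close>, a left inverse because \<open>encode_pairs\<close> is injective.
\<close>

definition covering_adj ::
  "(bool list \<Rightarrow> bool list \<Rightarrow> bool) \<Rightarrow> bool list \<Rightarrow> bool list \<Rightarrow> bool" where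
  "covering_adj adj x y \<longleftrightarrow>
     (\<exists>i a b. (i, a) \<in> set (inv encode_pairs x) \<and> (i, b) \<in> set (inv encode_pairs y) \<and> adj a b)"

definition covering_len :: "nat \<Rightarrow> (nat \<Rightarrow> nat) \<Rightarrow> nat \<Rightarrow> nat" where
  "covering_len c len n = c * (2 * name_length c n + 2 * len n + 2)"

lemma covering_len_bigo_ln:
  assumes "(\<lambda>n. real (len n)) \<in> O(\<lambda>n. ln (real n))"
  shows "(\<lambda>n. real (covering_len c len n)) \<in> O(\<lambda>n. ln (real n))"
proof -
  have "(\<lambda>n. real (2 * name_length c n + 2 * len n + 2)) \<in> O(\<lambda>n. ln (real n))"
    unfolding of_nat_add of_nat_mult
    by (intro sum_in_bigo const_bigo_ln) (use assms name_length_bigo_ln in simp_all)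
  then show ?thesis
    unfolding covering_len_def of_nat_mult[of c] by (cases "c = 0") simp_all
qed

text \<open>
  The code of a vertex lists its (name, local code) pairs in an arbitrary order. Names are injective
  on the nonempty members, so equal names in the codes of \<open>u\<close> and \<open>v\<close> point to a single member
  containing both, and the local codes then decide adjacency in that member.
\<close>

lemma covering_code:
  assumes cov: "covering G \<H>"
    and c: "\<And>v. v \<in> pverts G \<Longrightarrow> card {H \<in> \<H>. v \<in> pverts H} \<le> c"
    and len: "mono len"
      "\<And>H v. H \<in> \<H> \<Longrightarrow> v \<in> pverts H \<Longrightarrow> length (code H v) \<le> len (card (pverts H))"
    and adj: "\<And>H u v. H \<in> \<H> \<Longrightarrow> u \<in> pverts H \<Longrightarrow> v \<in> pverts H \<Longrightarrow> u \<noteq> v \<Longrightarrow>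
      (u, v) \<in> parcs H \<longleftrightarrow> adj (code H u) (code H v)"
  obtains code' where
    "\<And>v. v \<in> pverts G \<Longrightarrow> length (code' v) \<le> covering_len c len (card (pverts G))"
    "\<And>u v. u \<in> pverts G \<Longrightarrow> v \<in> pverts G \<Longrightarrow> u \<noteq> v \<Longrightarrow>
      (u, v) \<in> parcs G \<longleftrightarrow> covering_adj adj (code' u) (code' v)"
proof -
  let ?n = "card (pverts G)"
  have fin_\<H>: "finite \<H>" and pg: "\<And>H. H \<in> \<H> \<Longrightarrow> pair_graph H"
    and verts: "pverts G = (\<Union>H\<in>\<H>. pverts H)" and arcs: "parcs G = (\<Union>H\<in>\<H>. parcs H)"
    using cov by (auto simp: covering_def)
  have fin_H: "finite (pverts H)" if "H \<in> \<H>" for H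
  proof -
    interpret pair_graph H by (rule pg[OF that])
    show ?thesis by (rule pair_finite_verts)
  qed
  have ends: "u \<in> pverts H \<and> v \<in> pverts H" if "H \<in> \<H>" "(u, v) \<in> parcs H" for H u v
  proof -
    interpret pair_graph H by (rule pg[OF that(1)])
    show ?thesis using that(2) by (auto dest: in_arcsD1 in_arcsD2)
  qed
  have fin_G: "finite (pverts G)"
    unfolding verts using fin_\<H> fin_H by blast
  define members where "members = {H \<in> \<H>. pverts H \<noteq> {}}"
  have "card members \<le> 2 ^ name_length c ?n"
    using card_nonempty_members_le[OF cov fin_G c] le_two_power_name_length[of c ?n]
    unfolding members_def by linarith
  moreover have "finite members"
    using fin_\<H> by (simp add: members_def)
  ultimately obtain name :: "'a pair_pre_digraph \<Rightarrow> bool list" where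
    name: "inj_on name members" "\<And>H. H \<in> members \<Longrightarrow> length (name H) = name_length c ?n"
    using ex_names by blast
  have "\<exists>Hs. set Hs = {H \<in> \<H>. v \<in> pverts H} \<and> distinct Hs" for v
    using fin_\<H> by (intro finite_distinct_list) simp
  then obtain Hs where Hs: "\<And>v. set (Hs v) = {H \<in> \<H>. v \<in> pverts H}" "\<And>v. distinct (Hs v)"
    by metis
  define entries where "entries v = map (\<lambda>H. (name H, code H v)) (Hs v)" for v
  have in_entries: "(i, a) \<in> set (entries v) \<longleftrightarrow>
      (\<exists>H\<in>\<H>. v \<in> pverts H \<and> i = name H \<and> a = code H v)" for i a v
    by (auto simp: entries_def Hs)
  show thesis
  proof
    fix v assume v: "v \<in> pverts G"
    have "length (entries v) \<le> c"
      using c[OF v] distinct_card[OF Hs(2)[of v]] by (simp add: entries_def Hs)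
    moreover have "length (encode_pairs (entries v))
        \<le> length (entries v) * (2 * name_length c ?n + 2 * len ?n + 2)"
    proof (rule length_encode_pairs_le)
      fix i a assume "(i, a) \<in> set (entries v)"
      then obtain H where H: "H \<in> \<H>" "v \<in> pverts H" "i = name H" "a = code H v"
        by (auto simp: in_entries)
      have "card (pverts H) \<le> ?n"
        using H(1) fin_G verts by (intro card_mono) auto
      then have "len (card (pverts H)) \<le> len ?n"
        using len(1) by (simp add: monoD)
      moreover have "H \<in> members"
        using H by (auto simp: members_def)
      ultimately show "length i \<le> name_length c ?n \<and> length a \<le> len ?n"
        using H len(2)[OF H(1,2)] name(2)[of H] by simp
    qed
    ultimately show "length (encode_pairs (entries v)) \<le> covering_len c len ?n"
      unfolding covering_len_def by (meson mult_le_mono1 order_trans)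
  next
    fix u v :: 'a assume "u \<noteq> v"
    have "covering_adj adj (encode_pairs (entries u)) (encode_pairs (entries v)) \<longleftrightarrow>
        (\<exists>H\<in>\<H>. \<exists>H'\<in>\<H>. u \<in> pverts H \<and> v \<in> pverts H' \<and> name H = name H' \<and>
          adj (code H u) (code H' v))"
      unfolding covering_adj_def inv_f_f[OF inj_encode_pairs] in_entries by metis
    also have "\<dots> \<longleftrightarrow> (\<exists>H\<in>\<H>. u \<in> pverts H \<and> v \<in> pverts H \<and> adj (code H u) (code H v))"
      using inj_onD[OF name(1)] unfolding members_def by blast
    also have "\<dots> \<longleftrightarrow> (\<exists>H\<in>\<H>. (u, v) \<in> parcs H)"
      using adj \<open>u \<noteq> v\<close> ends by blast
    also have "\<dots> \<longleftrightarrow> (u, v) \<in> parcs G"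
      by (simp add: arcs)
    finally show "(u, v) \<in> parcs G \<longleftrightarrow>
        covering_adj adj (encode_pairs (entries u)) (encode_pairs (entries v))" ..
  qed
qed

theorem lemma4:
  fixes X Y :: "'a pair_pre_digraph set" and c :: nat
  assumes "graph_class X"
    and "graph_class Y"
    and "implicit_representation Y"
    and "\<And>G. G \<in> X \<Longrightarrow>
           \<exists>\<H>. covering G \<H> \<and> \<H> \<subseteq> Y \<and> (\<forall>v\<in>pverts G. card {H \<in> \<H>. v \<in> pverts H} \<le> c)"
  shows "implicit_representation X"
proof -
  from assms(3) obtain len adj where len: "(\<lambda>n. real (len n)) \<in> O(\<lambda>n. ln (real n))"
    and "\<forall>H\<in>Y. \<exists>code :: 'a \<Rightarrow> bool list.
       (\<forall>v\<in>pverts H. length (code v) \<le> len (card (pverts H))) \<and>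
       (\<forall>u\<in>pverts H. \<forall>v\<in>pverts H. u \<noteq> v \<longrightarrow> ((u, v) \<in> parcs H \<longleftrightarrow> adj (code u) (code v)))"
    unfolding implicit_representation_def by blast
  then obtain code :: "'a pair_pre_digraph \<Rightarrow> 'a \<Rightarrow> bool list" where
    code: "\<And>H v. H \<in> Y \<Longrightarrow> v \<in> pverts H \<Longrightarrow> length (code H v) \<le> len (card (pverts H))"
      "\<And>H u v. H \<in> Y \<Longrightarrow> u \<in> pverts H \<Longrightarrow> v \<in> pverts H \<Longrightarrow> u \<noteq> v \<Longrightarrow>
        (u, v) \<in> parcs H \<longleftrightarrow> adj (code H u) (code H v)"
    by metis
  from len obtain len' where len': "mono len'" "\<And>n. len n \<le> len' n"
    "(\<lambda>n. real (len' n)) \<in> O(\<lambda>n. ln (real n))"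
    by (rule ex_mono_majorant_bigo_ln) blast
  have "\<exists>code'. (\<forall>v\<in>pverts G. length (code' v) \<le> covering_len c len' (card (pverts G))) \<and>
      (\<forall>u\<in>pverts G. \<forall>v\<in>pverts G. u \<noteq> v \<longrightarrow>
        ((u, v) \<in> parcs G \<longleftrightarrow> covering_adj adj (code' u) (code' v)))"
    if "G \<in> X" for G
  proof -
    obtain \<H> where \<H>: "covering G \<H>" "\<H> \<subseteq> Y"
      "\<And>v. v \<in> pverts G \<Longrightarrow> card {H \<in> \<H>. v \<in> pverts H} \<le> c"
      using assms(4)[OF \<open>G \<in> X\<close>] by blast
    have "length (code H v) \<le> len' (card (pverts H))" if "H \<in> \<H>" "v \<in> pverts H" for H v
      using code(1)[of H v] that \<H>(2) len'(2) by (meson order_trans subsetD)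
    moreover have "(u, v) \<in> parcs H \<longleftrightarrow> adj (code H u) (code H v)"
      if "H \<in> \<H>" "u \<in> pverts H" "v \<in> pverts H" "u \<noteq> v" for H u v
      using code(2)[of H u v] that \<H>(2) by blast
    ultimately obtain code' where
      "\<And>v. v \<in> pverts G \<Longrightarrow> length (code' v) \<le> covering_len c len' (card (pverts G))"
      "\<And>u v. u \<in> pverts G \<Longrightarrow> v \<in> pverts G \<Longrightarrow> u \<noteq> v \<Longrightarrow>
        (u, v) \<in> parcs G \<longleftrightarrow> covering_adj adj (code' u) (code' v)"
      using covering_code[OF \<H>(1,3) len'(1), of code adj] by blast
    then show ?thesis by blast
  qed
  then show ?thesis
    unfolding implicit_representation_def
    using covering_len_bigo_ln[OF len'(3)] by blast
qed

end
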